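(* Let $p,q\in\mathbb{R}$. (i) If $0\le q\le \min\left(\frac{17p}{23},\frac p3+\frac{8}{15}\right)$ or $q\le \min\left(0,p,\frac p3+\frac8{15}\right)$, then for all $x\in(0,\infty)$ $$\frac{\left(\frac{\sinh x}{x}\right)^p-1}{p}>\frac13\,\frac{\cosh^q x-1}{q}\quad\text{if }pq\ne0,$$ $$\ln\frac{\sinh x}{x}>\frac13\,\frac{\cosh^q x-1}{q}\quad\text{if }p=0,\ q\neq0,$$ $$\frac{\left(\frac{\sinh x}{x}\right)^p-1}{p}>\frac13\ln\cosh x\quad\text{if }p\ne0,\ q=0,$$ $$\ln\frac{\sinh x}{x}>\frac13\ln\cosh x\quad\text{if }p=q=0,$$ where $1/3$ is the best constant (it cannot be replaced by any larger constant). (ii) If $\max\left(\frac{17p}{23},\frac p3+\frac8{15}\right)\le q<0$ or $q\ge\max\left(0,p,\frac p3+\frac8{15}\right)$, then the first three inequalities above (the cases $pq\neq 0$; $p=0,q\ne0$; $p\neq0,q=0$) are reversed, i.e. they hold for all $x\in(0,\infty)$ with $<$ in place of $>$. *)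

theory Defs imports Complex_Main
begin

end

theory Submission imports Defs "HOL-Real_Asymp.Real_Asymp"
begin

text \<open>
  Put \<open>u = sinh x / x\<close>, \<open>w = 3 (x cosh x - sinh x) / x^3\<close> and let \<open>U p t\<close> be the power
  \<open>(t^p - 1) / p\<close>, with \<open>U 0 = ln\<close>. The derivative of \<open>U p u - U q (cosh x) / 3\<close> has the sign of
  \<open>G p q = (p - 2) ln u + ln w - (q - 1) ln (cosh x)\<close>, which is affine in \<open>(p, q)\<close>. Hence its sign
  on the two polygonal parameter regions is decided at the vertices \<open>(0, 0)\<close>, \<open>(46/35, 34/35)\<close>
  and \<open>(4/5, 4/5)\<close>, and along the unbounded edges, where \<open>ln u < ln (cosh x) < 3 ln u\<close> suffices.
  At the last two vertices \<open>G\<close> is differentiated once more; the numerator of the derivative is a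
  power series in \<open>x\<close> whose coefficients all have the same sign.
\<close>

section \<open>Positivity from a positive derivative and a zero limit at 0\<close>

lemma DERIV_pos_limit_0_imp_pos:
  fixes f :: "real \<Rightarrow> real"
  assumes deriv: "\<And>x. x > 0 \<Longrightarrow> (f has_real_derivative f' x) (at x)"
    and pos: "\<And>x. x > 0 \<Longrightarrow> f' x > 0"
    and lim: "(f \<longlongrightarrow> 0) (at_right 0)"
    and x: "x > 0"
  shows "f x > 0"
proof -
  have mono: "f y < f z" if "0 < y" "y < z" for y z
  proof (rule DERIV_pos_imp_increasing[where f = f])
    fix u
    assume "y \<le> u"
    then have "u > 0" using that by simp
    then show "\<exists>d. (f has_real_derivative d) (at u) \<and> d > 0"
      using deriv pos by blast
  qed (use that in simp)
  \<comment> \<open>Passing to the limit keeps only the weak inequality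
    \<open>0 \<le> f (x / 2)\<close>; the further increase from \<open>x / 2\<close> to
    \<open>x\<close> restores strictness.\<close>
  have "eventually (\<lambda>y. f y \<le> f (x / 2)) (at_right 0)"
    unfolding eventually_at_right_field using x mono
    by (intro exI[of _ "x / 2"]) (auto intro!: less_imp_le)
  then have "0 \<le> f (x / 2)"
    by (intro tendsto_upperbound[OF lim]) auto
  also have "\<dots> < f x" using x by (intro mono) auto
  finally show ?thesis .
qed

section \<open>Power series of hyperbolic expressions\<close>

lemma cosh_sums: "(\<lambda>n. if even n then y ^ n / fact n else 0) sums cosh (y::real)"
  using cosh_converges[of y] by (simp add: scaleR_conv_of_real field_simps cong: if_cong)

text \<open>Multiplication by \<open>y\<close> shifts the index and turns
  \<open>1 / (n - 1)!\<close> into \<open>n / n!\<close>; the factor \<open>n\<close> removes the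
  constant term that the shift adds. In this common form, with terms \<open>y ^ n / fact n\<close>
  for even \<open>n\<close>, series can be combined coefficient by coefficient.\<close>

lemma times_sinh_sums:
  "(\<lambda>n. if even n then real n * (y ^ n / fact n) else 0) sums (y * sinh (y::real))"
proof -
  have "(\<lambda>n. y * (if even n then 0 else y ^ n /\<^sub>R fact n)) sums (y * sinh y)"
    by (intro sums_mult sinh_converges)
  also have "(\<lambda>n. y * (if even n then 0 else y ^ n /\<^sub>R fact n)) =
    (\<lambda>n. if even (Suc n) then real (Suc n) * (y ^ Suc n / fact (Suc n)) else 0)"
    by (auto simp: fun_eq_iff field_simps simp del: of_nat_Suc)
  finally show ?thesis
    by (subst (asm) sums_Suc_iff) simp
qed

lemma square_times_cosh_sums:
  "(\<lambda>n. if even n then real n * (real n - 1) * (y ^ n / fact n) else 0) sums (y\<^sup>2 * cosh (y::real))"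
proof -
  have "(\<lambda>n. y\<^sup>2 * (if even n then y ^ n / fact n else 0)) sums (y\<^sup>2 * cosh y)"
    by (intro sums_mult cosh_sums)
  also have "(\<lambda>n. y\<^sup>2 * (if even n then y ^ n / fact n else 0)) =
    (\<lambda>n. if even (Suc (Suc n)) then real (Suc (Suc n)) * (real (Suc (Suc n)) - 1) *
       (y ^ Suc (Suc n) / fact (Suc (Suc n))) else 0)"
    by (auto simp: fun_eq_iff power2_eq_square divide_simps)
  finally show ?thesis
    by (subst (asm) sums_Suc_iff, subst (asm) sums_Suc_iff) simp
qed

lemma sums_even_pos:
  fixes x :: real
  assumes S: "(\<lambda>n. if even n then a n * (x ^ n / fact n) else 0) sums S"
    and nonneg: "\<And>n. even n \<Longrightarrow> a n \<ge> 0" and pos: "even m" "a m > 0" and x: "x > 0"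
  shows "S > 0"
proof -
  have "0 < suminf (\<lambda>n. if even n then a n * (x ^ n / fact n) else 0)"
    by (rule suminf_pos2[where i = m]) (use S nonneg pos x in \<open>auto simp: sums_iff\<close>)
  then show ?thesis using S by (simp add: sums_iff)
qed

text \<open>Covers the derivative numerators at both nontrivial vertices. The factors 1/9 and 1/3
  arise because the series for \<open>y\<^sup>2 * cosh y\<close> and \<open>y * sinh y\<close> are
  taken at \<open>y = 3 * x\<close>, which also produces \<open>3 ^ n\<close>.\<close>

lemma hyperbolic_combination_sums:
  fixes x :: real
  shows "(\<lambda>n. if even n then
            ((A / 9 * (real n * (real n - 1)) + C / 3 * real n + E) * 3 ^ n
             + (B * (real n * (real n - 1)) + D * real n + F)) * (x ^ n / fact n) else 0) sums
         (x\<^sup>2 * (A * cosh (3 * x) + B * cosh x) + x * (C * sinh (3 * x) + D * sinh x)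
           + (E * cosh (3 * x) + F * cosh x))"
proof -
  let ?e = "\<lambda>t n. if even (n::nat) then (t::real) else 0"
  have "(\<lambda>n. A / 9 * ?e (real n * (real n - 1) * ((3 * x) ^ n / fact n)) n
           + B * ?e (real n * (real n - 1) * (x ^ n / fact n)) n
           + C / 3 * ?e (real n * ((3 * x) ^ n / fact n)) n
           + D * ?e (real n * (x ^ n / fact n)) n
           + E * ?e ((3 * x) ^ n / fact n) n
           + F * ?e (x ^ n / fact n) n) sums
        (A / 9 * ((3 * x)\<^sup>2 * cosh (3 * x)) + B * (x\<^sup>2 * cosh x)
          + C / 3 * (3 * x * sinh (3 * x)) + D * (x * sinh x) + E * cosh (3 * x) + F * cosh x)"
    by (intro sums_add sums_mult square_times_cosh_sums times_sinh_sums cosh_sums)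
  also have "(\<lambda>n. A / 9 * ?e (real n * (real n - 1) * ((3 * x) ^ n / fact n)) n
           + B * ?e (real n * (real n - 1) * (x ^ n / fact n)) n
           + C / 3 * ?e (real n * ((3 * x) ^ n / fact n)) n
           + D * ?e (real n * (x ^ n / fact n)) n
           + E * ?e ((3 * x) ^ n / fact n) n
           + F * ?e (x ^ n / fact n) n) =
      (\<lambda>n. ?e (((A / 9 * (real n * (real n - 1)) + C / 3 * real n + E) * 3 ^ n
             + (B * (real n * (real n - 1)) + D * real n + F)) * (x ^ n / fact n)) n)"
    by (auto simp: fun_eq_iff power_mult_distrib algebra_simps add_divide_distrib diff_divide_distrib)
  also have "A / 9 * ((3 * x)\<^sup>2 * cosh (3 * x)) + B * (x\<^sup>2 * cosh x)
          + C / 3 * (3 * x * sinh (3 * x)) + D * (x * sinh x) + E * cosh (3 * x) + F * cosh x =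
      x\<^sup>2 * (A * cosh (3 * x) + B * cosh x) + x * (C * sinh (3 * x) + D * sinh x)
           + (E * cosh (3 * x) + F * cosh x)"
    by (simp add: power2_eq_square algebra_simps)
  finally show ?thesis .
qed

section \<open>Signs of the numerator series at the two nontrivial vertices\<close>

lemma nat_le_5_cases:
  fixes k :: nat
  obtains "k = 0" | "k = 1" | "k = 2" | "k = 3" | "k = 4" | "k \<ge> 5"
  by linarith

text \<open>With \<open>n = 2 * k\<close> this reads \<open>3 ^ n \<ge> 108 * n\<^sup>2\<close>,
  which absorbs the negative quadratic part of the coefficients. The induction works because
  \<open>k + 1 \<le> 3 * k\<close>.\<close>

lemma nine_power_ge: "k \<ge> 5 \<Longrightarrow> (9::real) ^ k \<ge> 108 * (2 * real k)\<^sup>2"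
proof (induction k rule: nat_induct_at_least)
  case base
  show ?case by simp
next
  case (Suc k)
  have "(real (Suc k))\<^sup>2 \<le> (3 * real k)\<^sup>2"
    using Suc.hyps by (intro power_mono) auto
  then have "108 * (2 * real (Suc k))\<^sup>2 \<le> 9 * (108 * (2 * real k)\<^sup>2)"
    by (simp only: power_mult_distrib) simp
  also have "\<dots> \<le> 9 * 9 ^ k" using Suc.IH by simp
  finally show ?case by simp
qed

text \<open>
  The vertex \<open>(46/35, 34/35)\<close> is where the series below starts only at \<open>x^10\<close>; the factor
  \<open>12/9 n (n - 1) - 58/3 n + 81\<close> of \<open>3^n\<close> in its coefficients has negative discriminant.
\<close>

lemma vertex_numerator_pos:
  fixes x :: real
  assumes x: "x > 0"
  shows "x\<^sup>2 * (12 * cosh (3 * x) - 108 * cosh x) - x * (58 * sinh (3 * x) + 54 * sinh x)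
           + 81 * (cosh (3 * x) - cosh x) > 0" (is "?N > 0")
proof -
  define a :: "nat \<Rightarrow> real" where "a = (\<lambda>n.
    (12 / 9 * (real n * (real n - 1)) + (- 58) / 3 * real n + 81) * 3 ^ n
      + ((- 108) * (real n * (real n - 1)) + (- 54) * real n + (- 81)))"
  have large: "a (2 * k) > 0" if k: "k \<ge> 5" for k
  proof -
    let ?n = "real (2 * k)"
    \<comment> \<open>Completing the square: for \<open>n \<ge> 10\<close> the square is at least
      \<open>(9 / 4)\<^sup>2\<close>, so the factor of \<open>3 ^ n\<close> is at least 1.\<close>
    have "12 / 9 * (?n * (?n - 1)) - 58 / 3 * ?n + 81 - 1 = (4 / 3) * ((?n - 31 / 4)\<^sup>2 - 1 / 16)"
      by (simp add: power2_eq_square field_simps)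
    moreover have "(?n - 31 / 4)\<^sup>2 \<ge> (9 / 4)\<^sup>2"
      using k by (intro power_mono) auto
    ultimately have "12 / 9 * (?n * (?n - 1)) - 58 / 3 * ?n + 81 \<ge> 1"
      by (simp add: power2_eq_square)
    then have "(12 / 9 * (?n * (?n - 1)) - 58 / 3 * ?n + 81) * 3 ^ (2 * k) \<ge> 1 * 3 ^ (2 * k)"
      by (intro mult_right_mono) auto
    moreover have "(3::real) ^ (2 * k) \<ge> 108 * ?n\<^sup>2"
      using nine_power_ge[OF k] by (simp add: power_mult)
    moreover have "a (2 * k) = (12 / 9 * (?n * (?n - 1)) - 58 / 3 * ?n + 81) * 3 ^ (2 * k)
        - 108 * ?n\<^sup>2 + 54 * ?n - 81"
      unfolding a_def by algebra
    ultimately show ?thesis using k by linarith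
  qed
  have nonneg: "a n \<ge> 0" if "even n" for n
  proof -
    from that obtain k where n: "n = 2 * k" by blast
    show ?thesis
      by (cases k rule: nat_le_5_cases) (use large[of k] in \<open>auto simp: n a_def\<close>)
  qed
  have "(\<lambda>n. if even n then a n * (x ^ n / fact n) else 0) sums ?N"
    using hyperbolic_combination_sums[of 12 "- 58" 81 "- 108" "- 54" "- 81" x]
    by (simp add: a_def algebra_simps cong: if_cong)
  then show ?thesis
    by (rule sums_even_pos[of a x _ "10"]) (use x nonneg large[of 5] in auto)
qed

text \<open>This belongs to the vertex \<open>(4/5, 4/5)\<close>, where the terms
  \<open>x\<^sup>2 * cosh (3 * x)\<close> and \<open>x * sinh x\<close> drop out. The coefficients
  of the negated series vanish up to \<open>x^6\<close>; from \<open>n = 8\<close> on,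
  \<open>4 / 3 * n\<close> exceeds 9 and they are positive.\<close>

lemma vertex_numerator_neg:
  fixes x :: real
  assumes x: "x > 0"
  shows "- 24 * x\<^sup>2 * cosh x - 4 * x * sinh (3 * x) + 9 * (cosh (3 * x) - cosh x) < 0" (is "?N < 0")
proof -
  define a :: "nat \<Rightarrow> real" where "a = (\<lambda>n.
    (0 / 9 * (real n * (real n - 1)) + 4 / 3 * real n + (- 9)) * 3 ^ n
      + (24 * (real n * (real n - 1)) + 0 * real n + 9))"
  have large: "a (2 * k) > 0" if k: "k \<ge> 4" for k
    using k by (auto simp: a_def intro!: add_nonneg_pos mult_nonneg_nonneg)
  have nonneg: "a n \<ge> 0" if "even n" for n
  proof -
    from that obtain k where n: "n = 2 * k" by blast
    show ?thesis
      by (cases k rule: nat_le_5_cases) (use large[of k] in \<open>auto simp: n a_def\<close>)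
  qed
  have "(\<lambda>n. if even n then a n * (x ^ n / fact n) else 0) sums (- ?N)"
    using hyperbolic_combination_sums[of 0 4 "- 9" 24 0 9 x]
    by (simp add: a_def algebra_simps cong: if_cong)
  then have "- ?N > 0"
    by (rule sums_even_pos[of a x _ "8"]) (use x nonneg large[of 4] in auto)
  then show ?thesis by simp
qed

section \<open>Logarithmic inequalities\<close>

definition sinhc :: "real \<Rightarrow> real" where
  "sinhc x = sinh x / x"

text \<open>The derivative of \<open>sinhc\<close> divided by \<open>x / 3\<close>. This
  normalisation gives the limit 1 at 0, so that its logarithm tends to 0 there.\<close>

definition cosh_excess :: "real \<Rightarrow> real" where
  "cosh_excess x = 3 * (x * cosh x - sinh x) / x ^ 3"

lemma x_cosh_minus_sinh_pos:
  fixes x :: real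
  assumes "x > 0"
  shows "x * cosh x - sinh x > 0"
proof (rule DERIV_pos_limit_0_imp_pos[OF _ _ _ assms])
  show "((\<lambda>x. x * cosh x - sinh x) has_real_derivative x * sinh x) (at x)" for x :: real
    by (auto intro!: derivative_eq_intros)
  show "x * sinh x > 0" if "x > 0" for x :: real
    using that by simp
  show "((\<lambda>x::real. x * cosh x - sinh x) \<longlongrightarrow> 0) (at_right 0)"
    by real_asymp
qed

lemma sinh_gt_self:
  fixes x :: real
  assumes "x > 0"
  shows "sinh x > x"
proof -
  have "sinh x - x > 0"
  proof (rule DERIV_pos_limit_0_imp_pos[OF _ _ _ assms])
    show "((\<lambda>x. sinh x - x) has_real_derivative cosh x - 1) (at x)" for x :: real
      by (auto intro!: derivative_eq_intros)
    show "cosh x - 1 > 0" if "x > 0" for x :: real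
      using that cosh_real_strict_mono[of 0 x] by simp
    show "((\<lambda>x::real. sinh x - x) \<longlongrightarrow> 0) (at_right 0)"
      by real_asymp
  qed
  then show ?thesis by simp
qed

lemma sinhc_gt_1: "x > 0 \<Longrightarrow> sinhc x > 1"
  using sinh_gt_self[of x] by (simp add: sinhc_def)

lemma sinhc_less_cosh: "x > 0 \<Longrightarrow> sinhc x < cosh x"
  using x_cosh_minus_sinh_pos[of x] by (simp add: sinhc_def field_simps)

lemma cosh_excess_pos: "x > 0 \<Longrightarrow> cosh_excess x > 0"
  using x_cosh_minus_sinh_pos[of x] by (simp add: cosh_excess_def)

lemma tendsto_sinhc: "(sinhc \<longlongrightarrow> 1) (at_right 0)"
  unfolding sinhc_def by real_asymp

lemma tendsto_cosh_excess: "(cosh_excess \<longlongrightarrow> 1) (at_right 0)"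
  unfolding cosh_excess_def by real_asymp

lemma tendsto_cosh_0: "(cosh \<longlongrightarrow> (1::real)) (at_right 0)"
  by real_asymp

lemma tendsto_ln_sinhc: "((\<lambda>x. ln (sinhc x)) \<longlongrightarrow> 0) (at_right 0)"
  using tendsto_ln[OF tendsto_sinhc] by simp

lemma tendsto_ln_cosh_excess: "((\<lambda>x. ln (cosh_excess x)) \<longlongrightarrow> 0) (at_right 0)"
  using tendsto_ln[OF tendsto_cosh_excess] by simp

lemma tendsto_ln_cosh: "((\<lambda>x. ln (cosh x)) \<longlongrightarrow> (0::real)) (at_right 0)"
  using tendsto_ln[OF tendsto_cosh_0] by simp

lemma DERIV_sinhc:
  assumes "x > 0"
  shows "(sinhc has_real_derivative (x * cosh x - sinh x) / x\<^sup>2) (at x)"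
  unfolding sinhc_def using assms
  by (auto intro!: derivative_eq_intros simp: power2_eq_square field_simps)

lemma DERIV_ln_sinhc:
  assumes "x > 0"
  shows "((\<lambda>x. ln (sinhc x)) has_real_derivative (x * cosh x - sinh x) / (x * sinh x)) (at x)"
proof -
  have "((\<lambda>x. ln (sinhc x)) has_real_derivative
      inverse (sinhc x) * ((x * cosh x - sinh x) / x\<^sup>2)) (at x)"
    using sinhc_gt_1[OF assms] by (intro DERIV_chain2[OF DERIV_ln DERIV_sinhc[OF assms]]) auto
  also have "inverse (sinhc x) * ((x * cosh x - sinh x) / x\<^sup>2) = (x * cosh x - sinh x) / (x * sinh x)"
    using assms by (simp add: sinhc_def power2_eq_square field_simps)
  finally show ?thesis .
qed

lemma DERIV_ln_cosh_excess:
  assumes x: "x > 0"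
  shows "((\<lambda>x. ln (cosh_excess x)) has_real_derivative
           x * sinh x / (x * cosh x - sinh x) - 3 / x) (at x)"
proof -
  note pos = x_cosh_minus_sinh_pos[OF x]
  have "((\<lambda>x. ln 3 + ln (x * cosh x - sinh x) - 3 * ln x) has_real_derivative
           x * sinh x / (x * cosh x - sinh x) - 3 / x) (at x)"
    using x pos by (auto intro!: derivative_eq_intros simp: field_simps)
  \<comment> \<open>Splitting the logarithm of the quotient requires a positive argument, so the two
    functions are compared only near \<open>x\<close>.\<close>
  moreover have "eventually (\<lambda>y. y \<in> {0<..}) (nhds x)"
    using x by (intro eventually_nhds_in_open) auto
  then have "eventually (\<lambda>y. ln (cosh_excess y) = ln 3 + ln (y * cosh y - sinh y) - 3 * ln y) (nhds x)"
  proof eventually_elim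
    case (elim y)
    define D where "D = y * cosh y - sinh y"
    have "D > 0" using x_cosh_minus_sinh_pos[of y] elim by (simp add: D_def)
    then show ?case using elim
      unfolding cosh_excess_def D_def[symmetric] by (simp add: ln_div ln_mult ln_realpow)
  qed
  ultimately show ?thesis by (subst DERIV_cong_ev) auto
qed

lemma DERIV_ln_cosh: "((\<lambda>x. ln (cosh x)) has_real_derivative sinh x / cosh x) (at (x::real))"
  by (auto intro!: derivative_eq_intros simp: field_simps)

lemma vertex_origin_aux:
  fixes x :: real
  assumes "x > 0"
  shows "3 * (x * cosh x - sinh x) * cosh x > x * (sinh x)\<^sup>2"
proof -
  \<comment> \<open>This is the difference of the two sides after
    \<open>sinh\<^sup>2 = cosh\<^sup>2 - 1\<close>; in this form its derivative factors as
    \<open>4 * sinh x * (x * cosh x - sinh x)\<close>.\<close>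
  have "x * (2 * (cosh x)\<^sup>2 + 1) - 3 * sinh x * cosh x > 0"
  proof (rule DERIV_pos_limit_0_imp_pos[OF _ _ _ assms])
    show "((\<lambda>x. x * (2 * (cosh x)\<^sup>2 + 1) - 3 * sinh x * cosh x) has_real_derivative
        4 * sinh x * (x * cosh x - sinh x)) (at x)" for x :: real
      by (auto intro!: derivative_eq_intros simp: power2_eq_square algebra_simps)
         (use cosh_square_eq[of x] in \<open>simp add: power2_eq_square algebra_simps\<close>)
    show "4 * sinh x * (x * cosh x - sinh x) > 0" if "x > 0" for x :: real
      using that x_cosh_minus_sinh_pos[of x] by simp
    show "((\<lambda>x::real. x * (2 * (cosh x)\<^sup>2 + 1) - 3 * sinh x * cosh x) \<longlongrightarrow> 0) (at_right 0)"
      by real_asymp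
  qed
  moreover have "3 * (x * cosh x - sinh x) * cosh x - x * (sinh x)\<^sup>2 =
      x * (2 * (cosh x)\<^sup>2 + 1) - 3 * sinh x * cosh x"
    using sinh_square_eq[of x] by algebra
  ultimately show ?thesis by simp
qed

text \<open>The value of \<open>G\<close> at \<open>(0, 0)\<close>: clearing denominators in
  \<open>(sinhc x)\<^sup>2 < cosh_excess x * cosh x\<close> gives exactly
  \<open>vertex_origin_aux\<close>.\<close>

lemma ln_vertex_origin:
  assumes x: "x > 0"
  shows "ln (cosh_excess x) - 2 * ln (sinhc x) + ln (cosh x) > 0"
proof -
  have "(sinhc x)\<^sup>2 < cosh_excess x * cosh x"
    using vertex_origin_aux[OF x] x
    by (simp add: sinhc_def cosh_excess_def power2_eq_square power3_eq_cube field_simps)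
  then have "ln ((sinhc x)\<^sup>2) < ln (cosh_excess x * cosh x)"
    using sinhc_gt_1[OF x] by (subst ln_less_cancel_iff) (auto intro: less_trans[of _ "(sinhc x)\<^sup>2"])
  then show ?thesis
    using sinhc_gt_1[OF x] cosh_excess_pos[OF x] by (simp add: ln_mult ln_realpow)
qed

text \<open>Lazarevic's inequality in logarithmic form. Positivity of the derivative is again
  \<open>vertex_origin_aux\<close>. It controls \<open>G\<close> along edges of slope 1/3.\<close>

lemma ln_cosh_less_3_ln_sinhc:
  assumes "x > 0"
  shows "ln (cosh x) < 3 * ln (sinhc x)"
proof -
  have "3 * ln (sinhc x) - ln (cosh x) > 0"
  proof (rule DERIV_pos_limit_0_imp_pos[OF _ _ _ assms])
    show "((\<lambda>x. 3 * ln (sinhc x) - ln (cosh x)) has_real_derivative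
        3 * ((x * cosh x - sinh x) / (x * sinh x)) - sinh x / cosh x) (at x)" if "x > 0" for x
      by (intro DERIV_diff DERIV_cmult DERIV_ln_sinhc DERIV_ln_cosh that)
    show "3 * ((x * cosh x - sinh x) / (x * sinh x)) - sinh x / cosh x > 0" if "x > 0" for x :: real
      using that vertex_origin_aux[OF that] by (simp add: field_simps power2_eq_square)
    show "((\<lambda>x. 3 * ln (sinhc x) - ln (cosh x)) \<longlongrightarrow> 0) (at_right 0)"
      using tendsto_diff[OF tendsto_mult_right_zero[OF tendsto_ln_sinhc, of 3] tendsto_ln_cosh] by simp
  qed
  then show ?thesis by simp
qed

section \<open>The vertices \<open>(46/35, 34/35)\<close> and \<open>(4/5, 4/5)\<close>\<close>

lemma cosh_triple: "cosh (3 * x) = 4 * cosh x ^ 3 - 3 * cosh (x::real)"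
proof -
  have "cosh (3 * x) = cosh (2 * x + x)" by simp
  also have "\<dots> = 4 * cosh x ^ 3 - 3 * cosh x"
    unfolding cosh_add cosh_double sinh_double using cosh_square_eq[of x] by algebra
  finally show ?thesis .
qed

lemma sinh_triple: "sinh (3 * x) = 4 * sinh x ^ 3 + 3 * sinh (x::real)"
proof -
  have "sinh (3 * x) = sinh (2 * x + x)" by simp
  also have "\<dots> = 4 * sinh x ^ 3 + 3 * sinh x"
    unfolding sinh_add cosh_double sinh_double using cosh_square_eq[of x] by algebra
  finally show ?thesis .
qed

text \<open>With \<open>a = p - 2\<close> and \<open>b = 1 - q\<close> the function is
  \<open>G p q\<close>. The triple-argument formulas replace cubic products of \<open>sinh x\<close>
  and \<open>cosh x\<close> by terms with explicit power series; the factor 4 clears their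
  denominators.\<close>

lemma DERIV_ln_combination:
  assumes x: "x > 0"
  shows "((\<lambda>x. a * ln (sinhc x) + ln (cosh_excess x) + b * ln (cosh x)) has_real_derivative
     (x\<^sup>2 * ((a + 1 + b) * cosh (3 * x) + (3 * a - 1 - b) * cosh x)
       - x * ((2 * a + 3 + b) * sinh (3 * x) + (2 * a + 3 - 3 * b) * sinh x)
       + (a + 3) * (cosh (3 * x) - cosh x))
     / (4 * (x * sinh x * cosh x * (x * cosh x - sinh x)))) (at x)"
proof -
  define D where "D = x * cosh x - sinh x"
  have D: "D > 0" using x_cosh_minus_sinh_pos[OF x] by (simp add: D_def)
  have "((\<lambda>x. a * ln (sinhc x) + ln (cosh_excess x) + b * ln (cosh x)) has_real_derivative
     a * (D / (x * sinh x)) + (x * sinh x / D - 3 / x) + b * (sinh x / cosh x)) (at x)"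
    unfolding D_def
    by (intro DERIV_add DERIV_cmult DERIV_ln_sinhc DERIV_ln_cosh_excess DERIV_ln_cosh x)
  also have "a * (D / (x * sinh x)) + (x * sinh x / D - 3 / x) + b * (sinh x / cosh x) =
     4 * (a * cosh x * D\<^sup>2 + sinh x * cosh x * (x\<^sup>2 * sinh x - 3 * D) + b * x * (sinh x)\<^sup>2 * D)
       / (4 * (x * sinh x * cosh x * D))"
    using x D by (simp add: field_simps power2_eq_square)
  also have "4 * (a * cosh x * D\<^sup>2 + sinh x * cosh x * (x\<^sup>2 * sinh x - 3 * D) + b * x * (sinh x)\<^sup>2 * D) =
     x\<^sup>2 * ((a + 1 + b) * cosh (3 * x) + (3 * a - 1 - b) * cosh x)
       - x * ((2 * a + 3 + b) * sinh (3 * x) + (2 * a + 3 - 3 * b) * sinh x)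
       + (a + 3) * (cosh (3 * x) - cosh x)"
  proof -
    have s: "sinh x ^ 2 = cosh x ^ 2 - 1" by (rule sinh_square_eq)
    show ?thesis unfolding cosh_triple sinh_triple D_def
      using s by algebra
  qed
  finally show ?thesis by (simp add: D_def)
qed

lemma tendsto_ln_combination:
  "((\<lambda>x. a * ln (sinhc x) + ln (cosh_excess x) + b * ln (cosh x)) \<longlongrightarrow> 0) (at_right 0)"
  using tendsto_add_zero[OF tendsto_add_zero[OF tendsto_mult_right_zero[OF tendsto_ln_sinhc, of a]
    tendsto_ln_cosh_excess] tendsto_mult_right_zero[OF tendsto_ln_cosh, of b]] .

text \<open>The vertex where \<open>q = 17 * p / 23\<close> meets \<open>q = p / 3 + 8 / 15\<close>.
  The derivative numerator is 1/35 of the expression in \<open>vertex_numerator_pos\<close>.\<close>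

lemma ln_vertex_upper:
  assumes "x > 0"
  shows "(- 24 / 35) * ln (sinhc x) + ln (cosh_excess x) + 1 / 35 * ln (cosh x) > 0"
proof (rule DERIV_pos_limit_0_imp_pos[OF DERIV_ln_combination _ tendsto_ln_combination assms])
  fix x :: real
  assume x: "x > 0"
  show "(x\<^sup>2 * ((- 24 / 35 + 1 + 1 / 35) * cosh (3 * x) + (3 * (- 24 / 35) - 1 - 1 / 35) * cosh x)
       - x * ((2 * (- 24 / 35) + 3 + 1 / 35) * sinh (3 * x) + (2 * (- 24 / 35) + 3 - 3 * (1 / 35)) * sinh x)
       + (- 24 / 35 + 3) * (cosh (3 * x) - cosh x))
     / (4 * (x * sinh x * cosh x * (x * cosh x - sinh x))) > 0"
    using x x_cosh_minus_sinh_pos[OF x] vertex_numerator_pos[OF x]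
    by (intro divide_pos_pos mult_pos_pos) (auto simp: field_simps)
qed

text \<open>The vertex where \<open>q = p\<close> meets \<open>q = p / 3 + 8 / 15\<close>. The
  derivative numerator is 1/5 of the expression in \<open>vertex_numerator_neg\<close>.\<close>

lemma ln_vertex_lower:
  assumes "x > 0"
  shows "(- 6 / 5) * ln (sinhc x) + ln (cosh_excess x) + 1 / 5 * ln (cosh x) < 0"
proof -
  have "- ((- 6 / 5) * ln (sinhc x) + ln (cosh_excess x) + 1 / 5 * ln (cosh x)) > 0"
  proof (rule DERIV_pos_limit_0_imp_pos[OF DERIV_minus[OF DERIV_ln_combination] _ _ assms])
    show "((\<lambda>x. - ((- 6 / 5) * ln (sinhc x) + ln (cosh_excess x) + 1 / 5 * ln (cosh x))) \<longlongrightarrow> 0) (at_right 0)"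
      using tendsto_minus[OF tendsto_ln_combination[of "- 6 / 5" "1 / 5"]] by simp
  next
    fix x :: real
    assume x: "x > 0"
    show "- ((x\<^sup>2 * ((- 6 / 5 + 1 + 1 / 5) * cosh (3 * x) + (3 * (- 6 / 5) - 1 - 1 / 5) * cosh x)
       - x * ((2 * (- 6 / 5) + 3 + 1 / 5) * sinh (3 * x) + (2 * (- 6 / 5) + 3 - 3 * (1 / 5)) * sinh x)
       + (- 6 / 5 + 3) * (cosh (3 * x) - cosh x))
     / (4 * (x * sinh x * cosh x * (x * cosh x - sinh x)))) > 0"
      unfolding neg_0_less_iff_less
      using x x_cosh_minus_sinh_pos[OF x] vertex_numerator_neg[OF x]
      by (intro divide_neg_pos mult_pos_pos) (auto simp: field_simps)
  qed
  then show ?thesis by simp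
qed

section \<open>From the vertices to the parameter regions\<close>

lemma convex_combination_pos:
  fixes a b t :: real
  assumes "a > 0" "b > 0" "0 \<le> t" "t \<le> 1"
  shows "(1 - t) * a + t * b > 0"
proof (cases "t = 1")
  case False
  then have "(1 - t) * a > 0" "t * b \<ge> 0" using assms by auto
  then show ?thesis by linarith
qed (use assms in simp)

lemma ln_region_pos:
  assumes x: "x > 0"
    and pq: "0 \<le> q \<and> q \<le> min (17 * p / 23) (p / 3 + 8 / 15) \<or> q \<le> min 0 (min p (p / 3 + 8 / 15))"
  shows "(p - 2) * ln (sinhc x) + ln (cosh_excess x) > (q - 1) * ln (cosh x)"
proof -
  define L M W where "L = ln (sinhc x)" and "M = ln (cosh x)" and "W = ln (cosh_excess x)"
  have L: "L > 0" using sinhc_gt_1[OF x] by (simp add: L_def)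
  have LM: "L < M"
    using sinhc_gt_1[OF x] sinhc_less_cosh[OF x] by (simp add: L_def M_def)
  have M3L: "M < 3 * L" using ln_cosh_less_3_ln_sinhc[OF x] by (simp add: L_def M_def)
  have origin: "W - 2 * L + M > 0" using ln_vertex_origin[OF x] by (simp add: L_def M_def W_def)
  have upper: "W - 24 / 35 * L + 1 / 35 * M > 0"
    using ln_vertex_upper[OF x] by (simp add: L_def M_def W_def)
  \<comment> \<open>The region with \<open>q \<le> 0\<close> falls under the first case; the one
    with \<open>q \<ge> 0\<close> is split at its vertex \<open>p = 46 / 35\<close>.\<close>
  consider "q \<le> 0" "q \<le> p" | "0 \<le> q" "q \<le> 17 * p / 23" "p \<le> 46 / 35"
    | "q \<le> p / 3 + 8 / 15" "p \<ge> 46 / 35"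
    using pq by fastforce
  then have "W - 2 * L + M + (p * L - q * M) > 0"
  proof cases
    case 1
    have "p * L \<ge> q * L" using 1 L by (intro mult_right_mono) auto
    moreover have "q * L \<ge> q * M" using 1 LM by (intro mult_left_mono_neg) auto
    ultimately show ?thesis using origin by linarith
  next
    case 2
    \<comment> \<open>Since \<open>M > 0\<close>, raising \<open>q\<close> to the edge only lowers
      \<open>G\<close>. The edge point \<open>(p, 17 * p / 23)\<close> is \<open>t\<close> times the
      vertex \<open>(46/35, 34/35)\<close>, and \<open>G\<close> is affine.\<close>
    define t where "t = 35 / 46 * p"
    have t: "0 \<le> t" "t \<le> 1" using 2 by (auto simp: t_def)
    have "q * M \<le> 17 * p / 23 * M" using 2 L LM by (intro mult_right_mono) auto
    moreover have "(1 - t) * (W - 2 * L + M) + t * (W - 24 / 35 * L + 1 / 35 * M) > 0"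
      by (rule convex_combination_pos) (use t origin upper in auto)
    moreover have "(1 - t) * (W - 2 * L + M) + t * (W - 24 / 35 * L + 1 / 35 * M) =
        W - 2 * L + M + (p * L - 17 * p / 23 * M)"
      by (simp add: t_def field_simps)
    ultimately show ?thesis by linarith
  next
    case 3
    have "q * M \<le> (p / 3 + 8 / 15) * M" using 3 L LM by (intro mult_right_mono) auto
    \<comment> \<open>The change of \<open>G\<close> along the ray of slope 1/3 that leaves the
      vertex.\<close>
    moreover have "(p - 46 / 35) * (L - M / 3) \<ge> 0" using 3 M3L by simp
    moreover have "W - 2 * L + M + (p * L - (p / 3 + 8 / 15) * M) =
        W - 24 / 35 * L + 1 / 35 * M + (p - 46 / 35) * (L - M / 3)"
      by (simp add: field_simps)
    ultimately show ?thesis using upper by linarith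
  qed
  then show ?thesis
    unfolding L_def M_def W_def by (simp add: algebra_simps)
qed

text \<open>Since \<open>M > 0\<close>, lowering \<open>q\<close> to the boundary raises
  \<open>G\<close>. The boundary consists of two rays from \<open>(4/5, 4/5)\<close>: slope 1/3 to
  the left and slope 1 to the right. \<open>G\<close> decreases along both away from the vertex, as
  \<open>L < M < 3 * L\<close>.\<close>

lemma ln_region_neg:
  assumes x: "x > 0" and pq: "q \<ge> p" "q \<ge> p / 3 + 8 / 15"
  shows "(p - 2) * ln (sinhc x) + ln (cosh_excess x) < (q - 1) * ln (cosh x)"
proof -
  define L M W where "L = ln (sinhc x)" and "M = ln (cosh x)" and "W = ln (cosh_excess x)"
  have L: "L > 0" using sinhc_gt_1[OF x] by (simp add: L_def)
  have LM: "L < M"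
    using sinhc_gt_1[OF x] sinhc_less_cosh[OF x] by (simp add: L_def M_def)
  have M3L: "M < 3 * L" using ln_cosh_less_3_ln_sinhc[OF x] by (simp add: L_def M_def)
  have lower: "W - 6 / 5 * L + 1 / 5 * M < 0"
    using ln_vertex_lower[OF x] by (simp add: L_def M_def W_def)
  have "W + (p - 2) * L - (q - 1) * M < 0"
  proof (cases "p \<le> 4 / 5")
    case True
    have "(p / 3 + 8 / 15) * M \<le> q * M" using pq L LM by (intro mult_right_mono) auto
    moreover have "(p - 4 / 5) * (L - M / 3) \<le> 0"
      using True M3L by (intro mult_nonpos_nonneg) auto
    moreover have "W + (p - 2) * L - ((p / 3 + 8 / 15) * M - M) =
        W - 6 / 5 * L + 1 / 5 * M + (p - 4 / 5) * (L - M / 3)"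
      by (simp add: field_simps)
    ultimately show ?thesis using lower by (simp add: algebra_simps)
  next
    case False
    have "p * M \<le> q * M" using pq L LM by (intro mult_right_mono) auto
    moreover have "(p - 4 / 5) * (L - M) \<le> 0"
      using False LM by (intro mult_nonneg_nonpos) auto
    moreover have "W + (p - 2) * L - (p * M - M) =
        W - 6 / 5 * L + 1 / 5 * M + (p - 4 / 5) * (L - M)"
      by (simp add: field_simps)
    ultimately show ?thesis using lower by (simp add: algebra_simps)
  qed
  then show ?thesis
    unfolding L_def M_def W_def by (simp add: algebra_simps)
qed

section \<open>Comparison of the normalised powers\<close>

text \<open>The Box-Cox transformation. For every \<open>p\<close>, including 0, it is the
  antiderivative of \<open>t powr (p - 1)\<close> vanishing at 1, so the four cases of the theorem
  can be handled as one.\<close>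

definition U :: "real \<Rightarrow> real \<Rightarrow> real" where
  "U p t = (if p = 0 then ln t else (t powr p - 1) / p)"

lemma DERIV_U:
  assumes "t > 0"
  shows "(U p has_real_derivative t powr (p - 1)) (at t)"
proof (cases "p = 0")
  case True
  then have "U p = ln" by (simp add: U_def fun_eq_iff)
  then show ?thesis using True assms DERIV_ln[OF assms] by (simp add: powr_minus)
next
  case False
  then have "U p = (\<lambda>t. (t powr p - 1) / p)" by (simp add: U_def fun_eq_iff)
  then show ?thesis using False assms
    by (auto intro!: derivative_eq_intros simp: powr_diff field_simps)
qed

lemma U_1 [simp]: "U p 1 = 0"
  by (simp add: U_def)

lemma U_pos:
  assumes "t > 1"
  shows "U p t > 0"
proof -
  have "U p 1 < U p t"
  proof (rule DERIV_pos_imp_increasing[where f = "U p"])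
    fix s :: real
    assume "1 \<le> s"
    then show "\<exists>y. (U p has_real_derivative y) (at s) \<and> y > 0"
      by (intro exI[of _ "s powr (p - 1)"]) (simp add: DERIV_U)
  qed (use assms in simp)
  then show ?thesis by simp
qed

text \<open>The derivative of \<open>sinhc\<close> is
  \<open>sinh x * cosh_excess x / (3 * sinhc x)\<close>, so \<open>sinh x / 3\<close> factors out of
  both terms. Writing the remaining positive factors as exponentials reduces the sign to a
  comparison of exponents, that is, to \<open>G\<close>.\<close>

lemma DERIV_U_difference:
  assumes x: "x > 0"
  shows "((\<lambda>x. U p (sinhc x) - 1 / 3 * U q (cosh x)) has_real_derivative
     sinh x / 3 * (exp ((p - 2) * ln (sinhc x) + ln (cosh_excess x)) - exp ((q - 1) * ln (cosh x)))) (at x)"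
proof -
  note pos = sinhc_gt_1[OF x] cosh_excess_pos[OF x]
  have "((\<lambda>x. U p (sinhc x) - 1 / 3 * U q (cosh x)) has_real_derivative
     sinhc x powr (p - 1) * ((x * cosh x - sinh x) / x\<^sup>2) - 1 / 3 * (cosh x powr (q - 1) * sinh x)) (at x)"
    using pos by (intro DERIV_diff DERIV_cmult DERIV_chain2[OF DERIV_U] DERIV_sinhc x)
      (auto intro!: derivative_eq_intros)
  also have "sinhc x powr (p - 1) = sinhc x powr (p - 2) * sinhc x"
    using pos powr_add[of "sinhc x" "p - 2" 1] by simp
  also have "sinhc x powr (p - 2) * sinhc x * ((x * cosh x - sinh x) / x\<^sup>2) =
      sinh x / 3 * (sinhc x powr (p - 2) * cosh_excess x)"
  proof -
    define P D where "P = sinhc x powr (p - 2)" and "D = x * cosh x - sinh x"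
    show ?thesis
      unfolding P_def[symmetric] cosh_excess_def D_def[symmetric]
      using x by (simp add: sinhc_def power2_eq_square power3_eq_cube mult_ac)
  qed
  also have "sinhc x powr (p - 2) * cosh_excess x = exp ((p - 2) * ln (sinhc x) + ln (cosh_excess x))"
    using pos by (simp add: powr_def exp_add)
  also have "cosh x powr (q - 1) = exp ((q - 1) * ln (cosh x))"
    using cosh_real_pos[of x] by (simp add: powr_def)
  finally show ?thesis
    by (simp only: right_diff_distrib) (simp add: mult_ac)
qed

lemma tendsto_U:
  assumes "(f \<longlongrightarrow> 1) F"
  shows "((\<lambda>x. U p (f x)) \<longlongrightarrow> 0) F"
  using isCont_tendsto_compose[OF DERIV_isCont[OF DERIV_U[of 1 p]] assms] by simp

lemma tendsto_U_difference:
  "((\<lambda>x. U p (sinhc x) - 1 / 3 * U q (cosh x)) \<longlongrightarrow> 0) (at_right 0)"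
  using tendsto_diff[OF tendsto_U[OF tendsto_sinhc, of p]
    tendsto_mult_right_zero[OF tendsto_U[OF tendsto_cosh_0, of q], of "1 / 3"]] by simp

lemma U_sinhc_greater:
  assumes "x > 0"
    and "0 \<le> q \<and> q \<le> min (17 * p / 23) (p / 3 + 8 / 15) \<or> q \<le> min 0 (min p (p / 3 + 8 / 15))"
  shows "U p (sinhc x) > 1 / 3 * U q (cosh x)"
proof -
  have "U p (sinhc x) - 1 / 3 * U q (cosh x) > 0"
    by (rule DERIV_pos_limit_0_imp_pos[OF DERIV_U_difference _ tendsto_U_difference assms(1)])
       (use ln_region_pos[OF _ assms(2)] in auto)
  then show ?thesis by simp
qed

lemma U_sinhc_less:
  assumes "x > 0" "q \<ge> p" "q \<ge> p / 3 + 8 / 15"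
  shows "U p (sinhc x) < 1 / 3 * U q (cosh x)"
proof -
  have "- (U p (sinhc x) - 1 / 3 * U q (cosh x)) > 0"
  proof (rule DERIV_pos_limit_0_imp_pos[OF DERIV_minus[OF DERIV_U_difference] _ _ assms(1)])
    show "((\<lambda>x. - (U p (sinhc x) - 1 / 3 * U q (cosh x))) \<longlongrightarrow> 0) (at_right 0)"
      using tendsto_minus[OF tendsto_U_difference] by simp
  qed (use ln_region_neg[OF _ assms(2,3)] in \<open>auto simp: mult_less_0_iff\<close>)
  then show ?thesis by simp
qed

section \<open>Optimality of the constant 1/3\<close>

lemma tendsto_U_quotient:
  assumes "(f \<longlongrightarrow> 1) F" "eventually (\<lambda>x. f x \<noteq> 1) F"
  shows "((\<lambda>x. U p (f x) / (f x - 1)) \<longlongrightarrow> 1) F"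
proof -
  \<comment> \<open>The difference quotient at 1, whose limit \<open>1 powr (p - 1) = 1\<close> is
    the same for all \<open>p\<close>.\<close>
  have "((\<lambda>t. (U p t - U p 1) / (t - 1)) \<longlongrightarrow> 1) (at 1)"
    using DERIV_U[of 1 p] by (simp add: has_field_derivative_iff)
  moreover have "filterlim f (at 1) F"
    using assms by (auto simp: filterlim_at)
  ultimately show ?thesis by (auto dest: filterlim_compose)
qed

text \<open>Near 0 the two powers behave like \<open>sinhc x - 1\<close> and
  \<open>cosh x - 1\<close>, that is, like \<open>x\<^sup>2 / 6\<close> and
  \<open>x\<^sup>2 / 2\<close>. Their quotient tends to 1/3 for all \<open>p\<close> and
  \<open>q\<close>, which rules out a larger constant.\<close>

lemma one_third_best:
  assumes c: "c > 1 / 3"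
  shows "\<not> (\<forall>x>0. U p (sinhc x) > c * U q (cosh x))"
proof
  assume *: "\<forall>x>0. U p (sinhc x) > c * U q (cosh x)"
  have gt0: "eventually (\<lambda>x. x > 0) (at_right (0::real))"
    by (rule eventually_at_right_less)
  have cosh_gt_1: "cosh x > 1" if "x > 0" for x :: real
    using that cosh_real_strict_mono[of 0 x] by simp
  have lim_p: "((\<lambda>x. U p (sinhc x) / (sinhc x - 1)) \<longlongrightarrow> 1) (at_right 0)"
    by (rule tendsto_U_quotient[OF tendsto_sinhc], rule eventually_mono[OF gt0])
       (auto dest: sinhc_gt_1)
  have lim_q: "((\<lambda>x. U q (cosh x) / (cosh x - 1)) \<longlongrightarrow> 1) (at_right (0::real))"
    by (rule tendsto_U_quotient[OF tendsto_cosh_0], rule eventually_mono[OF gt0])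
       (auto dest: cosh_gt_1)
  have lim_ratio: "((\<lambda>x. (sinhc x - 1) / (cosh x - 1)) \<longlongrightarrow> 1 / 3) (at_right 0)"
    unfolding sinhc_def by real_asymp
  have "((\<lambda>x. U p (sinhc x) / (sinhc x - 1) / (U q (cosh x) / (cosh x - 1))
      * ((sinhc x - 1) / (cosh x - 1))) \<longlongrightarrow> 1 / 1 * (1 / 3)) (at_right 0)"
    by (rule tendsto_mult[OF tendsto_divide[OF lim_p lim_q] lim_ratio]) simp
  moreover have "eventually (\<lambda>x. U p (sinhc x) / (sinhc x - 1) / (U q (cosh x) / (cosh x - 1))
      * ((sinhc x - 1) / (cosh x - 1)) \<ge> c) (at_right 0)"
    using gt0
  proof eventually_elim
    case (elim x)
    have "c * U q (cosh x) \<le> U p (sinhc x)" using * elim by (auto intro: less_imp_le)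
    then have "c \<le> U p (sinhc x) / U q (cosh x)"
      using U_pos[OF cosh_gt_1[OF elim], of q] by (simp add: pos_le_divide_eq)
    then show ?case
      using sinhc_gt_1[OF elim] cosh_gt_1[OF elim] elim by simp
  qed
  ultimately have "c \<le> 1 / 1 * (1 / 3)"
    by (intro tendsto_lowerbound) auto
  then show False using c by simp
qed

section \<open>Translation of the results on \<open>U\<close> into the separate cases\<close>

theorem theorem1:
  fixes p q :: real
  shows "((0 \<le> q \<and> q \<le> min (17 * p / 23) (p / 3 + 8 / 15) \<or>
          q \<le> min 0 (min p (p / 3 + 8 / 15)) \<longrightarrow>
            (p \<noteq> 0 \<and> q \<noteq> 0 \<longrightarrow>
              (\<forall>x::real>0. ((sinh x / x) powr p - 1) / p > 1 / 3 * ((cosh x powr q - 1) / q)) \<and>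
              (\<forall>c::real>1 / 3. \<not> (\<forall>x::real>0. ((sinh x / x) powr p - 1) / p > c * ((cosh x powr q - 1) / q)))) \<and>
            (p = 0 \<and> q \<noteq> 0 \<longrightarrow>
              (\<forall>x::real>0. ln (sinh x / x) > 1 / 3 * ((cosh x powr q - 1) / q)) \<and>
              (\<forall>c::real>1 / 3. \<not> (\<forall>x::real>0. ln (sinh x / x) > c * ((cosh x powr q - 1) / q)))) \<and>
            (p \<noteq> 0 \<and> q = 0 \<longrightarrow>
              (\<forall>x::real>0. ((sinh x / x) powr p - 1) / p > 1 / 3 * ln (cosh x)) \<and>
              (\<forall>c::real>1 / 3. \<not> (\<forall>x::real>0. ((sinh x / x) powr p - 1) / p > c * ln (cosh x)))) \<and>
            (p = 0 \<and> q = 0 \<longrightarrow>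
              (\<forall>x::real>0. ln (sinh x / x) > 1 / 3 * ln (cosh x)) \<and>
              (\<forall>c::real>1 / 3. \<not> (\<forall>x::real>0. ln (sinh x / x) > c * ln (cosh x)))))) \<and>
         (max (17 * p / 23) (p / 3 + 8 / 15) \<le> q \<and> q < 0 \<or>
          q \<ge> max 0 (max p (p / 3 + 8 / 15)) \<longrightarrow>
            (p \<noteq> 0 \<and> q \<noteq> 0 \<longrightarrow>
              (\<forall>x::real>0. ((sinh x / x) powr p - 1) / p < 1 / 3 * ((cosh x powr q - 1) / q))) \<and>
            (p = 0 \<and> q \<noteq> 0 \<longrightarrow>
              (\<forall>x::real>0. ln (sinh x / x) < 1 / 3 * ((cosh x powr q - 1) / q))) \<and>
            (p \<noteq> 0 \<and> q = 0 \<longrightarrow>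
              (\<forall>x::real>0. ((sinh x / x) powr p - 1) / p < 1 / 3 * ln (cosh x))))"
proof -
  let ?I = "0 \<le> q \<and> q \<le> min (17 * p / 23) (p / 3 + 8 / 15) \<or> q \<le> min 0 (min p (p / 3 + 8 / 15))"
  let ?II = "max (17 * p / 23) (p / 3 + 8 / 15) \<le> q \<and> q < 0 \<or> q \<ge> max 0 (max p (p / 3 + 8 / 15))"
  have I: "(\<forall>x>0. U p (sinh x / x) > 1 / 3 * U q (cosh x)) \<and>
      (\<forall>c>1 / 3. \<not> (\<forall>x>0. U p (sinh x / x) > c * U q (cosh x)))" if ?I
    using U_sinhc_greater[OF _ that] one_third_best[where p = p and q = q] by (simp add: sinhc_def)
  have II: "\<forall>x>0. U p (sinh x / x) < 1 / 3 * U q (cosh x)" if ?II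
  proof -
    \<comment> \<open>If \<open>17 * p / 23 \<le> q < 0\<close>, then \<open>p\<close> is negative,
      so \<open>p < 17 * p / 23 \<le> q\<close>.\<close>
    have "q \<ge> p" "q \<ge> p / 3 + 8 / 15" using that by auto
    then show ?thesis using U_sinhc_less[where p = p and q = q] by (simp add: sinhc_def)
  qed
  have U_0: "U 0 t = ln t" and U_nonzero: "r \<noteq> 0 \<Longrightarrow> U r t = (t powr r - 1) / r" for r t
    by (simp_all add: U_def)
  show ?thesis
    by (intro conjI impI; (elim conjE)?) (use I II U_0 U_nonzero in simp_all)
qed

end
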